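(* Let $P$ be a finite graded bounded poset. Then the $\chi$-Chow polynomial $\mathrm{H}_P(x)$ of $P$ has non-negative coefficients and is unimodal.
   Context: For a finite graded bounded poset $P$ with rank function $\rho$ ($\rho_{st}=\rho(t)-\rho(s)$), the characteristic function is $\chi_{st}(x)=\sum_{s\le w\le t}\mu_{sw}x^{\rho_{wt}}$ (Möbius function $\mu$), an element of the incidence algebra (maps $[s,t]\mapsto a_{st}(x)\in\mathbb{Z}[x]$ with product $(ab)_{st}=\sum_{s\le w\le t}a_{sw}b_{wt}$). For $s<t$, $\chi_{st}$ is divisible by $x-1$; let $\overline{\chi}_{st}=\chi_{st}/(x-1)$ for $s<t$ and $\overline{\chi}_{ss}=-1$. The $\chi$-Chow function is $\mathrm{H}=-(\overline{\chi})^{-1}$ and the $\chi$-Chow polynomial of $P$ is $\mathrm{H}_P=\mathrm{H}_{\widehat0\widehat1}$. A polynomial $a_0+\dots+a_mx^m$ with non-negative coefficients is unimodal if $a_0\le\dots\le a_j\ge\dots\ge a_m$ for some $j$. *)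

theory Defs
  imports "HOL-Algebra.Order" "HOL-Algebra.Ring" "HOL-Computational_Algebra.Polynomial"
begin

definition covers :: "('a, 'm) gorder_scheme \<Rightarrow> 'a \<Rightarrow> 'a \<Rightarrow> bool"
  where "covers L s t \<longleftrightarrow> s \<in> carrier L \<and> t \<in> carrier L \<and> s \<sqsubset>\<^bsub>L\<^esub> t \<and>
    (\<nexists>w. w \<in> carrier L \<and> s \<sqsubset>\<^bsub>L\<^esub> w \<and> w \<sqsubset>\<^bsub>L\<^esub> t)"

text \<open>A finite bounded poset is graded iff it has such a function, which is then unique.\<close>

definition rank_function :: "('a, 'm) gorder_scheme \<Rightarrow> ('a \<Rightarrow> nat) \<Rightarrow> bool"
  where "rank_function L \<rho> \<longleftrightarrow>
    \<rho> \<bottom>\<^bsub>L\<^esub> = 0 \<and> (\<forall>s t. covers L s t \<longrightarrow> \<rho> t = Suc (\<rho> s))"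

locale finite_graded_bounded_poset =
  partial_order L + weak_partial_order_bottom L + weak_partial_order_top L
  for L :: "('a, 'm) gorder_scheme" (structure) and \<rho> :: "'a \<Rightarrow> nat" +
  assumes finite_carrier: "finite (carrier L)"
    and rank_function: "rank_function L \<rho>"

text \<open>
  A map on closed intervals is encoded as a function of the two end points that is \<open>0\<close>
  when these are not the end points of an interval of the poset.
\<close>

definition incidence_algebra ::
    "('a, 'm) gorder_scheme \<Rightarrow> ('a \<Rightarrow> 'a \<Rightarrow> 'b::comm_ring_1) ring"
  where "incidence_algebra L =
    \<lparr>carrier = {a. \<forall>s t. \<not> (s \<in> carrier L \<and> t \<in> carrier L \<and> s \<sqsubseteq>\<^bsub>L\<^esub> t) \<longrightarrow> a s t = 0},
     monoid.mult = (\<lambda>a b s t. if s \<in> carrier L \<and> t \<in> carrier L \<and> s \<sqsubseteq>\<^bsub>L\<^esub> t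
       then \<Sum>w\<in>\<lbrace>s..t\<rbrace>\<^bsub>L\<^esub>. a s w * b w t else 0),
     one = (\<lambda>s t. if s \<in> carrier L \<and> s = t then 1 else 0),
     zero = (\<lambda>s t. 0),
     add = (\<lambda>a b s t. a s t + b s t)\<rparr>"

definition zeta :: "('a, 'm) gorder_scheme \<Rightarrow> 'a \<Rightarrow> 'a \<Rightarrow> int"
  where "zeta L s t = (if s \<in> carrier L \<and> t \<in> carrier L \<and> s \<sqsubseteq>\<^bsub>L\<^esub> t then 1 else 0)"

definition moebius :: "('a, 'm) gorder_scheme \<Rightarrow> 'a \<Rightarrow> 'a \<Rightarrow> int"
  where "moebius L = inv\<^bsub>incidence_algebra L\<^esub> zeta L"

definition char_fun :: "('a, 'm) gorder_scheme \<Rightarrow> ('a \<Rightarrow> nat) \<Rightarrow> 'a \<Rightarrow> 'a \<Rightarrow> int poly"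
  where "char_fun L \<rho> s t = (if s \<in> carrier L \<and> t \<in> carrier L \<and> s \<sqsubseteq>\<^bsub>L\<^esub> t
    then \<Sum>w\<in>\<lbrace>s..t\<rbrace>\<^bsub>L\<^esub>. monom (moebius L s w) (\<rho> t - \<rho> w) else 0)"

definition reduced_char_fun :: "('a, 'm) gorder_scheme \<Rightarrow> ('a \<Rightarrow> nat) \<Rightarrow> 'a \<Rightarrow> 'a \<Rightarrow> int poly"
  where "reduced_char_fun L \<rho> s t = (if s \<in> carrier L \<and> t \<in> carrier L \<and> s \<sqsubseteq>\<^bsub>L\<^esub> t
    then if s = t then - 1 else char_fun L \<rho> s t div [:- 1, 1:] else 0)"

definition chow_fun :: "('a, 'm) gorder_scheme \<Rightarrow> ('a \<Rightarrow> nat) \<Rightarrow> 'a \<Rightarrow> 'a \<Rightarrow> int poly"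
  where "chow_fun L \<rho> =
    \<ominus>\<^bsub>incidence_algebra L\<^esub> (inv\<^bsub>incidence_algebra L\<^esub> reduced_char_fun L \<rho>)"

definition chow_poly :: "('a, 'm) gorder_scheme \<Rightarrow> ('a \<Rightarrow> nat) \<Rightarrow> int poly"
  where "chow_poly L \<rho> = chow_fun L \<rho> \<bottom>\<^bsub>L\<^esub> \<top>\<^bsub>L\<^esub>"

definition unimodal :: "int poly \<Rightarrow> bool"
  where "unimodal p \<longleftrightarrow>
    (\<exists>j \<le> degree p. mono_on {0..j} (coeff p) \<and> antimono_on {j..degree p} (coeff p))"

end

theory Submission
  imports Defs
begin

text \<open>
  Let \<open>C\<^sub>s\<^sub>t = (x\<^bsup>\<rho>(t) - \<rho>(s)\<^esup> - x) / (x - 1)\<close>, so that \<open>C\<^sub>s\<^sub>s = -1\<close>. Multiplying by the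
  Moebius function gives the reduced characteristic function, hence \<open>C H = - \<zeta>\<close>. With
  \<open>[n] = 1 + \<dots> + x\<^bsup>n-1\<^esup>\<close> this reads, for \<open>s < t\<close>,
  \<open>H\<^sub>s\<^sub>t = [\<rho>(t) - \<rho>(s)] + (\<Sum>s<w<t. x [\<rho>(w) - \<rho>(s) - 1] H\<^sub>w\<^sub>t)\<close>.
  By induction every summand is symmetric and unimodal with centre \<open>(\<rho>(t) - \<rho>(s) - 1) / 2\<close>.
\<close>

section \<open>Symmetric unimodal polynomials\<close>

text \<open>Coefficients at all integer indices: the reflection \<open>d - i\<close> and shifts by
  powers of x then avoid truncated subtraction.\<close>

definition int_coeff :: "'a::zero poly \<Rightarrow> int \<Rightarrow> 'a"
  where "int_coeff p i = (if i < 0 then 0 else coeff p (nat i))"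

text \<open>
  The coefficients only depend on, and decrease with, the distance from the centre \<open>d / 2\<close>.
  Since the coefficients at negative indices are \<open>0\<close>, they are then non-negative, and those
  at indices above \<open>d\<close> are \<open>0\<close>.
\<close>

definition symmetric_unimodal :: "int \<Rightarrow> int poly \<Rightarrow> bool"
  where "symmetric_unimodal d p \<longleftrightarrow>
    (\<forall>i j. \<bar>2 * i - d\<bar> \<le> \<bar>2 * j - d\<bar> \<longrightarrow> int_coeff p j \<le> int_coeff p i)"

lemma int_coeff_of_nat [simp]: "int_coeff p (int i) = coeff p i"
  by (simp add: int_coeff_def)

lemma int_coeff_0 [simp]: "int_coeff 0 i = 0"
  by (simp add: int_coeff_def)

lemma int_coeff_add: "int_coeff (p + q) i = int_coeff p i + int_coeff q i"
  by (simp add: int_coeff_def)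

lemma int_coeff_sum: "int_coeff (\<Sum>a\<in>A. f a) i = (\<Sum>a\<in>A. int_coeff (f a) i)"
  by (simp add: int_coeff_def coeff_sum)

lemma int_coeff_monom_mult: "int_coeff (monom c n * p) i = c * int_coeff p (i - int n)"
  by (auto simp: int_coeff_def coeff_monom_mult nat_diff_distrib')

lemma symmetric_unimodalD:
  assumes "symmetric_unimodal d p" and "\<bar>2 * i - d\<bar> \<le> \<bar>2 * j - d\<bar>"
  shows "int_coeff p j \<le> int_coeff p i"
  using assms by (simp add: symmetric_unimodal_def)

lemma symmetric_unimodal_reflect:
  assumes "symmetric_unimodal d p"
  shows "int_coeff p (d - i) = int_coeff p i"
  by (intro antisym symmetric_unimodalD[OF assms]) auto

text \<open>Reflection moves every index to the lower half without changing its coefficient or its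
  distance from \<open>d / 2\<close>; in that half \<open>step\<close> makes the coefficients
  increase.\<close>

lemma symmetric_unimodalI:
  assumes reflect: "\<And>i. int_coeff p (d - i) = int_coeff p i"
    and step: "\<And>i. 2 * i < d \<Longrightarrow> int_coeff p i \<le> int_coeff p (i + 1)"
  shows "symmetric_unimodal d p"
  unfolding symmetric_unimodal_def
proof (intro allI impI)
  fix i j assume ij: "\<bar>2 * i - d\<bar> \<le> \<bar>2 * j - d\<bar>"
  have mono: "int_coeff p j \<le> int_coeff p i" if "j \<le> i" "2 * i \<le> d + 1" for i j
    using that(1)
  proof (induction rule: int_le_induct)
    case base
    show ?case by simp
  next
    case (step k)
    then show ?case
      using assms(2)[of "k - 1"] that by auto
  qed
  define i' j' where "i' = min i (d - i)" and "j' = min j (d - j)"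
  have "int_coeff p i' = int_coeff p i" "int_coeff p j' = int_coeff p j"
    by (auto simp: i'_def j'_def min_def reflect)
  moreover have "j' \<le> i'" "2 * i' \<le> d + 1"
    using ij by (auto simp: i'_def j'_def min_def)
  ultimately show "int_coeff p j \<le> int_coeff p i"
    using mono by metis
qed

lemma symmetric_unimodal_coeff_nonneg:
  assumes "symmetric_unimodal d p"
  shows "0 \<le> coeff p i"
proof -
  \<comment> \<open>The chosen index is negative, so its coefficient is 0, and it is at least as far
    from \<open>d / 2\<close> as \<open>i\<close>.\<close>
  have "int_coeff p (- 1 - \<bar>d\<bar> - int i) \<le> int_coeff p (int i)"
    by (intro symmetric_unimodalD[OF assms]) auto
  moreover have "int_coeff p (- 1 - \<bar>d\<bar> - int i) = 0"
    unfolding int_coeff_def by (rule if_P) linarith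
  ultimately show ?thesis by simp
qed

lemma unimodal_if_symmetric_unimodal:
  assumes "symmetric_unimodal d p"
  shows "unimodal p"
proof -
  \<comment> \<open>The peak sits at the centre, rounded down. The minimum keeps
    \<open>j \<le> degree p\<close> also for \<open>p = 0\<close>, and \<open>nat\<close> sends a
    negative centre to 0.\<close>
  define j where "j = min (nat (d div 2)) (degree p)"
  have "coeff p i \<le> coeff p k" if "i \<le> k" "k \<le> j" for i k
  proof -
    have "int_coeff p (int i) \<le> int_coeff p (int k)"
      using that by (intro symmetric_unimodalD[OF assms]) (auto simp: j_def)
    then show ?thesis by simp
  qed
  moreover have "coeff p k \<le> coeff p i" if "j \<le> i" "i \<le> k" "k \<le> degree p" for i k
  \<comment> \<open>If \<open>j\<close> is the degree, then \<open>i = k\<close>. Otherwise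
    \<open>2 * i \<ge> d - 1\<close>, so \<open>i < k\<close> puts \<open>k\<close> beyond the
    centre.\<close>
  proof (cases "i = k")
    case False
    then have "int_coeff p (int k) \<le> int_coeff p (int i)"
      using that by (intro symmetric_unimodalD[OF assms]) (auto simp: j_def min_def split: if_splits)
    then show ?thesis by simp
  qed simp
  ultimately have "mono_on {0..j} (coeff p)" "antimono_on {j..degree p} (coeff p)"
    by (auto intro!: monotone_onI)
  moreover have "j \<le> degree p"
    by (simp add: j_def)
  ultimately show ?thesis
    unfolding unimodal_def by blast
qed

section \<open>Sums and geometric factors\<close>

lemma symmetric_unimodal_0: "symmetric_unimodal d 0"
  by (simp add: symmetric_unimodal_def)

lemma symmetric_unimodal_add:
  "symmetric_unimodal d p \<Longrightarrow> symmetric_unimodal d q \<Longrightarrow> symmetric_unimodal d (p + q)"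
  by (simp add: symmetric_unimodal_def int_coeff_add add_mono)

lemma symmetric_unimodal_sum:
  "(\<And>a. a \<in> A \<Longrightarrow> symmetric_unimodal d (f a)) \<Longrightarrow> symmetric_unimodal d (\<Sum>a\<in>A. f a)"
  by (induction A rule: infinite_finite_induct)
    (auto intro: symmetric_unimodal_0 symmetric_unimodal_add)

text \<open>The coefficient at \<open>i\<close> is 1 exactly if
  \<open>\<bar>2 * i - (n - 1)\<bar> \<le> n - 1\<close>, and 0 otherwise.\<close>

lemma symmetric_unimodal_geometric: "symmetric_unimodal (int n - 1) (\<Sum>i<n. monom 1 i)"
proof -
  have "int_coeff (\<Sum>i<n. monom (1::int) i) i = (if 0 \<le> i \<and> i < int n then 1 else 0)" for i
    by (auto simp: int_coeff_def coeff_sum)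
  then show ?thesis
    by (auto simp: symmetric_unimodal_def)
qed

text \<open>The factor has centre \<open>n / 2\<close>, and doubled centres add under
  multiplication. Consecutive coefficients of the product differ by a telescoping sum, which leaves
  just two coefficients of \<open>p\<close> to compare.\<close>

lemma symmetric_unimodal_geometric_mult:
  assumes p: "symmetric_unimodal d p" and "0 < n"
  shows "symmetric_unimodal (d + int n) ((\<Sum>i=1..<n. monom 1 i) * p)"
proof (rule symmetric_unimodalI)
  let ?q = "(\<Sum>i=1..<n. monom 1 i) * p"
  have q: "int_coeff ?q m = (\<Sum>i=1..<n. int_coeff p (m - int i))" for m
    by (simp add: sum_distrib_right int_coeff_sum int_coeff_monom_mult)
  show "int_coeff ?q (d + int n - m) = int_coeff ?q m" for m
    unfolding q
  \<comment> \<open>The map \<open>i \<mapsto> n - i\<close> reverses the exponents 1 to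
    \<open>n - 1\<close> and turns the reflection of the product into that of
    \<open>p\<close>.\<close>
  proof (rule sum.reindex_bij_witness[of _ "\<lambda>i. n - i" "\<lambda>i. n - i"])
    fix i assume "i \<in> {1..<n}"
    then have "d + int n - m - int i = d - (m - int (n - i))"
      by simp
    then show "int_coeff p (m - int (n - i)) = int_coeff p (d + int n - m - int i)"
      using symmetric_unimodal_reflect[OF p] by metis
  qed auto
  show "int_coeff ?q m \<le> int_coeff ?q (m + 1)" if "2 * m < d + int n" for m
  proof -
    have "int_coeff ?q (m + 1) - int_coeff ?q m =
        (\<Sum>i=1..<n. int_coeff p (m - int (i - 1)) - int_coeff p (m - int i))"
      unfolding q sum_subtractf[symmetric] by (intro sum.cong) (auto simp: of_nat_diff algebra_simps)
    also have "\<dots> = int_coeff p m - int_coeff p (m + 1 - int n)"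
      using \<open>0 < n\<close> by (induction n rule: nat_induct_non_zero) (auto simp: algebra_simps)
    \<comment> \<open>The indices \<open>m\<close> and \<open>m + 1 - n\<close> lie around the
      midpoint \<open>m - (n - 1) / 2\<close>; it is at most \<open>d / 2\<close> since
      \<open>2 * m - d \<le> n - 1\<close>, so \<open>m\<close> is the one nearer to the
      centre.\<close>
    also have "0 \<le> \<dots>"
      using symmetric_unimodalD[OF p, of m "m + 1 - int n"] that \<open>0 < n\<close> by auto
    finally show ?thesis by simp
  qed
qed

section \<open>The incidence algebra\<close>

locale finite_partial_order = partial_order L for L :: "('a, 'm) gorder_scheme" (structure) +
  assumes finite_carrier: "finite (carrier L)"
begin

lemma mem_interval_iff: "w \<in> \<lbrace>s..t\<rbrace> \<longleftrightarrow> w \<in> carrier L \<and> s \<sqsubseteq> w \<and> w \<sqsubseteq> t"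
  by (auto simp: at_least_at_most_def)

lemma interval_refl: "s \<in> carrier L \<Longrightarrow> \<lbrace>s..s\<rbrace> = {s}"
  by (auto simp: mem_interval_iff)

lemma finite_interval: "finite \<lbrace>s..t\<rbrace>"
  by (rule finite_subset[OF _ finite_carrier]) (auto simp: mem_interval_iff)

lemma incidence_mult:
  assumes "s \<in> carrier L" "t \<in> carrier L" "s \<sqsubseteq> t"
  shows "(a \<otimes>\<^bsub>incidence_algebra L\<^esub> b) s t = (\<Sum>w\<in>\<lbrace>s..t\<rbrace>. a s w * b w t)"
  using assms by (simp add: incidence_algebra_def)

lemma incidence_one:
  "\<one>\<^bsub>incidence_algebra L\<^esub> s t = (if s \<in> carrier L \<and> s = t then 1 else 0)"
  by (simp add: incidence_algebra_def)

lemma incidence_closedI: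
  assumes "\<And>s t. \<not> (s \<in> carrier L \<and> t \<in> carrier L \<and> s \<sqsubseteq> t) \<Longrightarrow> a s t = 0"
  shows "a \<in> carrier (incidence_algebra L)"
  using assms by (simp add: incidence_algebra_def)

lemma incidence_eqI:
  assumes "a \<in> carrier (incidence_algebra L)" "b \<in> carrier (incidence_algebra L)"
    and "\<And>s t. s \<in> carrier L \<Longrightarrow> t \<in> carrier L \<Longrightarrow> s \<sqsubseteq> t \<Longrightarrow> a s t = b s t"
  shows "a = b"
  using assms by (intro ext) (auto simp: incidence_algebra_def, metis)

section \<open>Ring structure and units\<close>

lemma incidence_mult_closed:
  "a \<otimes>\<^bsub>incidence_algebra L\<^esub> b \<in> carrier (incidence_algebra L)"
  by (simp add: incidence_algebra_def)

text \<open>Both sides sum over the chains from \<open>s\<close> via \<open>u\<close> and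
  \<open>w\<close> to \<open>t\<close>. Subintervals are written as filters of the whole interval so
  that the two summations can be swapped.\<close>

lemma incidence_mult_assoc:
  "(a \<otimes>\<^bsub>incidence_algebra L\<^esub> b) \<otimes>\<^bsub>incidence_algebra L\<^esub> c =
    a \<otimes>\<^bsub>incidence_algebra L\<^esub> (b \<otimes>\<^bsub>incidence_algebra L\<^esub> c)"
proof (intro incidence_eqI incidence_mult_closed)
  fix s t assume st: "s \<in> carrier L" "t \<in> carrier L" "s \<sqsubseteq> t"
  have 1: "\<lbrace>s..w\<rbrace> = {u \<in> \<lbrace>s..t\<rbrace>. u \<sqsubseteq> w}" if "w \<in> \<lbrace>s..t\<rbrace>" for w
    using that st by (auto simp: mem_interval_iff intro: le_trans)
  have 2: "\<lbrace>u..t\<rbrace> = {w \<in> \<lbrace>s..t\<rbrace>. u \<sqsubseteq> w}" if "u \<in> \<lbrace>s..t\<rbrace>" for u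
    using that st by (auto simp: mem_interval_iff intro: le_trans)
  have "((a \<otimes>\<^bsub>incidence_algebra L\<^esub> b) \<otimes>\<^bsub>incidence_algebra L\<^esub> c) s t =
      (\<Sum>w\<in>\<lbrace>s..t\<rbrace>. \<Sum>u\<in>{u \<in> \<lbrace>s..t\<rbrace>. u \<sqsubseteq> w}. a s u * b u w * c w t)"
    unfolding incidence_mult[OF st]
  proof (rule sum.cong[OF HOL.refl])
    fix w assume w: "w \<in> \<lbrace>s..t\<rbrace>"
    show "(a \<otimes>\<^bsub>incidence_algebra L\<^esub> b) s w * c w t =
        (\<Sum>u\<in>{u \<in> \<lbrace>s..t\<rbrace>. u \<sqsubseteq> w}. a s u * b u w * c w t)"
      unfolding 1[OF w, symmetric] using st w
      by (simp add: incidence_mult mem_interval_iff sum_distrib_right)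
  qed
  also have "\<dots> = (\<Sum>u\<in>\<lbrace>s..t\<rbrace>. \<Sum>w\<in>{w \<in> \<lbrace>s..t\<rbrace>. u \<sqsubseteq> w}. a s u * b u w * c w t)"
    by (intro sum.swap_restrict finite_interval)
  also have "\<dots> = (a \<otimes>\<^bsub>incidence_algebra L\<^esub> (b \<otimes>\<^bsub>incidence_algebra L\<^esub> c)) s t"
    unfolding incidence_mult[OF st]
  proof (rule sum.cong[OF HOL.refl])
    fix u assume u: "u \<in> \<lbrace>s..t\<rbrace>"
    show "(\<Sum>w\<in>{w \<in> \<lbrace>s..t\<rbrace>. u \<sqsubseteq> w}. a s u * b u w * c w t) =
        a s u * (b \<otimes>\<^bsub>incidence_algebra L\<^esub> c) u t"
      unfolding 2[OF u, symmetric] using st u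
      by (simp add: incidence_mult mem_interval_iff sum_distrib_left mult.assoc)
  qed
  finally show "((a \<otimes>\<^bsub>incidence_algebra L\<^esub> b) \<otimes>\<^bsub>incidence_algebra L\<^esub> c) s t =
    (a \<otimes>\<^bsub>incidence_algebra L\<^esub> (b \<otimes>\<^bsub>incidence_algebra L\<^esub> c)) s t" .
qed

lemma ring_incidence_algebra: "ring (incidence_algebra L)"
proof (rule ringI)
  let ?I = "incidence_algebra L :: ('a \<Rightarrow> 'a \<Rightarrow> 'b) ring"
  show "abelian_group ?I"
  proof (rule abelian_groupI)
    fix a assume "a \<in> carrier ?I"
    then show "\<exists>b\<in>carrier ?I. b \<oplus>\<^bsub>?I\<^esub> a = \<zero>\<^bsub>?I\<^esub>"
      by (intro bexI[of _ "\<lambda>s t. - a s t"]) (auto simp: incidence_algebra_def)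
  qed (auto simp: incidence_algebra_def algebra_simps)
  have one: "\<one>\<^bsub>?I\<^esub> \<in> carrier ?I"
    by (auto simp: incidence_algebra_def)
  show "monoid ?I"
  proof (rule monoidI)
    fix a assume a: "a \<in> carrier ?I"
    have "(\<Sum>w\<in>\<lbrace>s..t\<rbrace>. (if w = s then a w t else 0)) = a s t"
        "(\<Sum>w\<in>\<lbrace>s..t\<rbrace>. (if w = t then a s w else 0)) = a s t"
      if "s \<in> carrier L" "t \<in> carrier L" "s \<sqsubseteq> t" for s t
      using that by (simp_all add: finite_interval mem_interval_iff)
    note * = this
    show "\<one>\<^bsub>?I\<^esub> \<otimes>\<^bsub>?I\<^esub> a = a"
      by (intro incidence_eqI incidence_mult_closed a)
        (auto simp: incidence_mult incidence_one mem_interval_iff *[symmetric] intro!: sum.cong)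
    show "a \<otimes>\<^bsub>?I\<^esub> \<one>\<^bsub>?I\<^esub> = a"
      by (intro incidence_eqI incidence_mult_closed a)
        (auto simp: incidence_mult incidence_one mem_interval_iff *(2)[symmetric] intro!: sum.cong)
  qed (auto simp: incidence_mult_closed incidence_mult_assoc one)
qed (auto simp: incidence_algebra_def sum.distrib algebra_simps fun_eq_iff)

text \<open>Solves the equation for a right inverse for its term \<open>w = s\<close>. Multiplying
  by \<open>a s s\<close> replaces dividing by it, as the diagonal entries of interest are 1 or
  -1.\<close>

function right_inverse :: "('a \<Rightarrow> 'a \<Rightarrow> 'b::comm_ring_1) \<Rightarrow> 'a \<Rightarrow> 'a \<Rightarrow> 'b"
  where "right_inverse a s t = (if s \<in> carrier L \<and> t \<in> carrier L \<and> s \<sqsubseteq> t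
    then a s s * ((if s = t then 1 else 0) - (\<Sum>w\<in>\<lbrace>s..t\<rbrace> - {s}. a s w * right_inverse a w t))
    else 0)"
  by pat_completeness auto
termination
proof (relation "measure (\<lambda>(a, s, t). card \<lbrace>s..t\<rbrace>)", goal_cases)
  \<comment> \<open>The inclusion is strict because \<open>s\<close> is not in the smaller interval:
    \<open>w \<noteq> s\<close>.\<close>
  case (2 a s t w)
  then have "\<lbrace>w..t\<rbrace> \<subset> \<lbrace>s..t\<rbrace>"
    by (auto simp: mem_interval_iff psubset_eq set_eq_iff intro: le_trans le_antisym)
  then show ?case
    by (simp add: finite_interval psubset_card_mono)
qed simp

declare right_inverse.simps [simp del]

lemma right_inverse_closed: "right_inverse a \<in> carrier (incidence_algebra L)"
  by (rule incidence_closedI) (auto simp: right_inverse.simps)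

lemma right_inverse:
  assumes diag: "\<And>s. s \<in> carrier L \<Longrightarrow> a s s * a s s = 1"
  shows "a \<otimes>\<^bsub>incidence_algebra L\<^esub> right_inverse a = \<one>\<^bsub>incidence_algebra L\<^esub>"
proof (intro incidence_eqI incidence_mult_closed)
  show "\<one>\<^bsub>incidence_algebra L\<^esub> \<in> carrier (incidence_algebra L)"
    by (auto simp: incidence_algebra_def)
  fix s t assume st: "s \<in> carrier L" "t \<in> carrier L" "s \<sqsubseteq> t"
  let ?S = "\<Sum>w\<in>\<lbrace>s..t\<rbrace> - {s}. a s w * right_inverse a w t"
  have "(a \<otimes>\<^bsub>incidence_algebra L\<^esub> right_inverse a) s t = a s s * right_inverse a s t + ?S"
    using st by (simp add: incidence_mult sum.remove[of _ s] finite_interval mem_interval_iff)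
  also have "a s s * right_inverse a s t = (a s s * a s s) * ((if s = t then 1 else 0) - ?S)"
    using st by (subst right_inverse.simps) (simp add: mult.assoc)
  finally show "(a \<otimes>\<^bsub>incidence_algebra L\<^esub> right_inverse a) s t = \<one>\<^bsub>incidence_algebra L\<^esub> s t"
    using st by (simp add: diag incidence_one)
qed

text \<open>The right inverse \<open>b\<close> of \<open>a\<close> has the same diagonal as
  \<open>a\<close>, so it has a right inverse \<open>c\<close> itself. Then
  \<open>a = a (b c) = (a b) c = c\<close>, and \<open>b\<close> is a two-sided inverse.\<close>

lemma incidence_UnitsI:
  assumes a: "a \<in> carrier (incidence_algebra L)"
    and diag: "\<And>s. s \<in> carrier L \<Longrightarrow> a s s * a s s = 1"
  shows "a \<in> Units (incidence_algebra L)"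
proof -
  let ?I = "incidence_algebra L"
  interpret I: ring ?I by (rule ring_incidence_algebra)
  define b where "b = right_inverse a"
  define c where "c = right_inverse b"
  have carr: "b \<in> carrier ?I" "c \<in> carrier ?I"
    by (simp_all add: b_def c_def right_inverse_closed)
  have "b s s = a s s" if "s \<in> carrier L" for s
    using that unfolding b_def by (subst right_inverse.simps) (simp add: interval_refl)
  then have bc: "b \<otimes>\<^bsub>?I\<^esub> c = \<one>\<^bsub>?I\<^esub>"
    unfolding c_def by (intro right_inverse) (simp add: diag)
  have ab: "a \<otimes>\<^bsub>?I\<^esub> b = \<one>\<^bsub>?I\<^esub>"
    unfolding b_def using diag by (rule right_inverse)
  have "a = c"
    using I.inv_unique[OF ab bc] a carr by simp
  with ab bc a carr show ?thesis
    unfolding Units_def by blast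
qed

lemma moebius:
  shows moebius_closed: "moebius L \<in> carrier (incidence_algebra L)"
    and moebius_zeta: "moebius L \<otimes>\<^bsub>incidence_algebra L\<^esub> zeta L = \<one>\<^bsub>incidence_algebra L\<^esub>"
    and zeta_moebius: "zeta L \<otimes>\<^bsub>incidence_algebra L\<^esub> moebius L = \<one>\<^bsub>incidence_algebra L\<^esub>"
proof -
  interpret I: ring "incidence_algebra L :: ('a \<Rightarrow> 'a \<Rightarrow> int) ring"
    by (rule ring_incidence_algebra)
  have "zeta L \<in> Units (incidence_algebra L)"
    by (rule incidence_UnitsI) (auto simp: zeta_def incidence_algebra_def)
  then show "moebius L \<in> carrier (incidence_algebra L)"
    "moebius L \<otimes>\<^bsub>incidence_algebra L\<^esub> zeta L = \<one>\<^bsub>incidence_algebra L\<^esub>"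
    "zeta L \<otimes>\<^bsub>incidence_algebra L\<^esub> moebius L = \<one>\<^bsub>incidence_algebra L\<^esub>"
    by (simp_all add: moebius_def)
qed

end

section \<open>The Chow function\<close>

sublocale finite_graded_bounded_poset \<subseteq> finite_partial_order
  by unfold_locales (rule finite_carrier)

context finite_graded_bounded_poset
begin

text \<open>The rank function is only constrained on covers; any other pair is split at an element
  strictly between, by induction on the size of the interval.\<close>

lemma rank_less:
  assumes "s \<in> carrier L" "t \<in> carrier L" "s \<sqsubseteq> t" "s \<noteq> t"
  shows "\<rho> s < \<rho> t"
  using assms
proof (induction "card \<lbrace>s..t\<rbrace>" arbitrary: s t rule: less_induct)
  case less
  show ?case
  proof (cases "covers L s t")
    case True
    then show ?thesis
      using rank_function by (auto simp: rank_function_def)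
  next
    case False
    then obtain w where w: "w \<in> carrier L" "s \<sqsubseteq> w" "w \<sqsubseteq> t" "w \<noteq> s" "w \<noteq> t"
      using less.prems by (auto simp: covers_def lless_eq)
    have "\<lbrace>s..w\<rbrace> \<subset> \<lbrace>s..t\<rbrace>" "\<lbrace>w..t\<rbrace> \<subset> \<lbrace>s..t\<rbrace>"
      using w less.prems
      by (auto simp: mem_interval_iff psubset_eq set_eq_iff intro: le_trans le_antisym)
    then have "card \<lbrace>s..w\<rbrace> < card \<lbrace>s..t\<rbrace>" "card \<lbrace>w..t\<rbrace> < card \<lbrace>s..t\<rbrace>"
      by (simp_all add: finite_interval psubset_card_mono)
    then have "\<rho> s < \<rho> w" "\<rho> w < \<rho> t"
      using less.hyps w less.prems by metis+
    then show ?thesis by simp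
  qed
qed

text \<open>This is \<open>(x\<^bsup>n\<^esup> - x) / (x - 1)\<close> for \<open>n = \<rho> t - \<rho> s\<close>.\<close>

definition chow_kernel :: "'a \<Rightarrow> 'a \<Rightarrow> int poly"
  where "chow_kernel s t = (if s \<in> carrier L \<and> t \<in> carrier L \<and> s \<sqsubseteq> t
    then if s = t then - 1 else \<Sum>i=1..<\<rho> t - \<rho> s. monom 1 i else 0)"

lemma chow_kernel_closed: "chow_kernel \<in> carrier (incidence_algebra L)"
  by (rule incidence_closedI) (auto simp: chow_kernel_def)

text \<open>Off the diagonal the product telescopes, the exponent being positive by
  \<open>rank_less\<close>. On the diagonal, \<open>1 - x = (x - 1) (-1)\<close> accounts for the
  value -1.\<close>

lemma chow_kernel_times:
  assumes "s \<in> carrier L" "t \<in> carrier L" "s \<sqsubseteq> t"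
  shows "[:- 1, 1:] * chow_kernel s t = monom 1 (\<rho> t - \<rho> s) - monom 1 1"
proof -
  have *: "[:- 1, 1:] * (\<Sum>i=1..<n. monom 1 i) = monom 1 n - monom (1::int) 1" if "0 < n" for n
    using that
  proof (induction n rule: nat_induct_non_zero)
    case (Suc n)
    then show ?case
      by (simp only: sum.atLeastLessThan_Suc distrib_left) (simp add: monom_Suc)
  qed simp
  show ?thesis
    using assms *[of "\<rho> t - \<rho> s"] rank_less[of s t]
    by (auto simp: chow_kernel_def monom_Suc)
qed

text \<open>After multiplication by \<open>x - 1\<close> the kernel splits into a power of x, which
  yields the characteristic function, and \<open>- x\<close>, whose contribution vanishes for
  \<open>s < t\<close> because the Moebius values sum to 0.\<close>

lemma const_moebius_mult_chow_kernel:
  "(\<lambda>s t. [:moebius L s t:]) \<otimes>\<^bsub>incidence_algebra L\<^esub> chow_kernel = reduced_char_fun L \<rho>"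
  (is "?m \<otimes>\<^bsub>?I\<^esub> _ = _")
proof (intro incidence_eqI incidence_mult_closed)
  show "reduced_char_fun L \<rho> \<in> carrier ?I"
    by (rule incidence_closedI) (auto simp: reduced_char_fun_def)
  fix s t assume st: "s \<in> carrier L" "t \<in> carrier L" "s \<sqsubseteq> t"
  have sum_moebius: "(\<Sum>w\<in>\<lbrace>s..t\<rbrace>. moebius L s w) = (if s = t then 1 else 0)"
  proof -
    have "(\<Sum>w\<in>\<lbrace>s..t\<rbrace>. moebius L s w) = (\<Sum>w\<in>\<lbrace>s..t\<rbrace>. moebius L s w * zeta L w t)"
      using st by (intro sum.cong) (auto simp: zeta_def mem_interval_iff)
    also have "\<dots> = (moebius L \<otimes>\<^bsub>incidence_algebra L\<^esub> zeta L) s t"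
      using st by (simp add: incidence_mult)
    finally show ?thesis
      using st by (simp add: moebius_zeta incidence_one)
  qed
  show "(?m \<otimes>\<^bsub>?I\<^esub> chow_kernel) s t = reduced_char_fun L \<rho> s t"
  proof (cases "s = t")
    case True
    with st sum_moebius show ?thesis
      by (simp add: interval_refl incidence_mult reduced_char_fun_def chow_kernel_def one_pCons)
  next
    case False
    have "[:- 1, 1:] * (?m \<otimes>\<^bsub>?I\<^esub> chow_kernel) s t =
        (\<Sum>w\<in>\<lbrace>s..t\<rbrace>. [:moebius L s w:] * ([:- 1, 1:] * chow_kernel w t))"
      using st by (simp only: incidence_mult sum_distrib_left mult.left_commute)
    also have "\<dots> = (\<Sum>w\<in>\<lbrace>s..t\<rbrace>. [:moebius L s w:] * (monom 1 (\<rho> t - \<rho> w) - monom 1 1))"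
      using st by (intro sum.cong HOL.refl arg_cong2[of _ _ _ _ "(*)"] chow_kernel_times)
        (auto simp: mem_interval_iff)
    also have "\<dots> = char_fun L \<rho> s t - monom (\<Sum>w\<in>\<lbrace>s..t\<rbrace>. moebius L s w) 1"
      using st by (simp add: char_fun_def smult_diff_right sum_subtractf smult_monom monom_sum)
    also have "\<dots> = char_fun L \<rho> s t"
      using False by (simp add: sum_moebius)
    \<comment> \<open>The identity exhibits the quotient, so the division is exact.\<close>
    finally have "char_fun L \<rho> s t div [:- 1, 1:] = (?m \<otimes>\<^bsub>?I\<^esub> chow_kernel) s t"
      by (metis nonzero_mult_div_cancel_left pCons_eq_0_iff zero_neq_one)
    then show ?thesis
      using st False by (simp add: reduced_char_fun_def)
  qed
qed

text \<open>Writing C for the kernel and R for the reduced characteristic function,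
  \<open>\<zeta> R = C\<close> by Moebius inversion, so
  \<open>C H = - \<zeta> R R\<^sup>-\<^sup>1 = - \<zeta>\<close>.\<close>

lemma chow_kernel_mult_chow_fun:
  assumes st: "s \<in> carrier L" "t \<in> carrier L" "s \<sqsubseteq> t"
  shows "(\<Sum>w\<in>\<lbrace>s..t\<rbrace>. chow_kernel s w * chow_fun L \<rho> w t) = - 1"
proof -
  let ?I = "incidence_algebra L :: ('a \<Rightarrow> 'a \<Rightarrow> int poly) ring"
  let ?m = "\<lambda>s t. [:moebius L s t:]" and ?z = "\<lambda>s t. [:zeta L s t:]"
  let ?r = "reduced_char_fun L \<rho>"
  interpret I: ring ?I by (rule ring_incidence_algebra)
  have carr: "?m \<in> carrier ?I" "?z \<in> carrier ?I" "?r \<in> carrier ?I"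
    using moebius_closed by (auto simp: incidence_algebra_def zeta_def reduced_char_fun_def)
  have "?r \<in> Units ?I"
    by (rule incidence_UnitsI[OF carr(3)]) (simp add: reduced_char_fun_def)
  then have inv: "inv\<^bsub>?I\<^esub> ?r \<in> carrier ?I" "?r \<otimes>\<^bsub>?I\<^esub> inv\<^bsub>?I\<^esub> ?r = \<one>\<^bsub>?I\<^esub>"
    by simp_all
  \<comment> \<open>Carries Moebius inversion over from the integers to constant
    polynomials.\<close>
  have zm: "?z \<otimes>\<^bsub>?I\<^esub> ?m = \<one>\<^bsub>?I\<^esub>"
  proof (intro incidence_eqI incidence_mult_closed I.one_closed)
    fix s t assume st: "s \<in> carrier L" "t \<in> carrier L" "s \<sqsubseteq> t"
    have "(?z \<otimes>\<^bsub>?I\<^esub> ?m) s t = [:(zeta L \<otimes>\<^bsub>incidence_algebra L\<^esub> moebius L) s t:]"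
      using st by (simp add: incidence_mult poly_eq_iff coeff_sum coeff_pCons mult.commute split: nat.split)
    then show "(?z \<otimes>\<^bsub>?I\<^esub> ?m) s t = \<one>\<^bsub>?I\<^esub> s t"
      using st by (simp add: zeta_moebius incidence_one one_pCons)
  qed
  have "?z \<otimes>\<^bsub>?I\<^esub> ?r = chow_kernel"
    using carr chow_kernel_closed zm
    by (simp add: const_moebius_mult_chow_kernel[symmetric] I.m_assoc[symmetric])
  then have "chow_kernel \<otimes>\<^bsub>?I\<^esub> inv\<^bsub>?I\<^esub> ?r = ?z \<otimes>\<^bsub>?I\<^esub> (?r \<otimes>\<^bsub>?I\<^esub> inv\<^bsub>?I\<^esub> ?r)"
    using I.m_assoc[OF carr(2,3) inv(1)] by simp
  then have "chow_kernel \<otimes>\<^bsub>?I\<^esub> chow_fun L \<rho> = \<ominus>\<^bsub>?I\<^esub> ?z"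
    unfolding chow_fun_def I.r_minus[OF chow_kernel_closed inv(1)] inv(2) I.r_one[OF carr(2)]
    by simp
  moreover have "\<ominus>\<^bsub>?I\<^esub> ?z = (\<lambda>s t. - ?z s t)"
    by (rule I.minus_equality) (use carr in \<open>auto simp: incidence_algebra_def\<close>)
  ultimately have "(chow_kernel \<otimes>\<^bsub>?I\<^esub> chow_fun L \<rho>) s t = - 1"
    using st by (simp add: zeta_def one_pCons)
  then show ?thesis
    using st by (simp add: incidence_mult)
qed

section \<open>Recursion and symmetry of the Chow function\<close>

lemma chow_fun_rec:
  assumes st: "s \<in> carrier L" "t \<in> carrier L" "s \<sqsubseteq> t"
  shows "chow_fun L \<rho> s t = 1 + (\<Sum>w\<in>\<lbrace>s..t\<rbrace> - {s}. chow_kernel s w * chow_fun L \<rho> w t)"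
proof -
  have "chow_kernel s s * chow_fun L \<rho> s t +
      (\<Sum>w\<in>\<lbrace>s..t\<rbrace> - {s}. chow_kernel s w * chow_fun L \<rho> w t) = - 1"
    using chow_kernel_mult_chow_fun[OF st] st
    by (simp add: sum.remove[of _ s] finite_interval mem_interval_iff)
  moreover have "chow_kernel s s = - 1"
    using st by (simp add: chow_kernel_def)
  ultimately show ?thesis
    by (simp add: algebra_simps add_eq_0_iff2)
qed

lemma chow_fun_refl:
  assumes "s \<in> carrier L"
  shows "chow_fun L \<rho> s s = 1"
  using assms by (simp add: chow_fun_rec interval_refl)

text \<open>The term \<open>w = t\<close> of the recursion is just the kernel, since the Chow
  function is 1 on the diagonal; together with the summand 1 it completes the geometric sum.\<close>

lemma chow_fun_less:
  assumes st: "s \<in> carrier L" "t \<in> carrier L" "s \<sqsubseteq> t" "s \<noteq> t"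
  shows "chow_fun L \<rho> s t = (\<Sum>i<\<rho> t - \<rho> s. monom 1 i) +
    (\<Sum>w\<in>\<lbrace>s..t\<rbrace> - {s, t}. (\<Sum>i=1..<\<rho> w - \<rho> s. monom 1 i) * chow_fun L \<rho> w t)"
proof -
  have "t \<in> \<lbrace>s..t\<rbrace> - {s}" "\<lbrace>s..t\<rbrace> - {s} - {t} = \<lbrace>s..t\<rbrace> - {s, t}"
    using st by (auto simp: mem_interval_iff)
  then have "chow_fun L \<rho> s t = 1 + chow_kernel s t +
      (\<Sum>w\<in>\<lbrace>s..t\<rbrace> - {s, t}. chow_kernel s w * chow_fun L \<rho> w t)"
    using st by (simp add: chow_fun_rec[of s] sum.remove[of _ t] finite_interval chow_fun_refl)
  also have "1 + chow_kernel s t = (\<Sum>i<\<rho> t - \<rho> s. monom 1 i)"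
    using st rank_less[OF st]
    by (simp add: chow_kernel_def lessThan_atLeast0 sum.atLeast_Suc_lessThan monom_0 one_pCons)
  also have "(\<Sum>w\<in>\<lbrace>s..t\<rbrace> - {s, t}. chow_kernel s w * chow_fun L \<rho> w t) =
      (\<Sum>w\<in>\<lbrace>s..t\<rbrace> - {s, t}. (\<Sum>i=1..<\<rho> w - \<rho> s. monom 1 i) * chow_fun L \<rho> w t)"
    using st by (intro sum.cong) (auto simp: chow_kernel_def mem_interval_iff)
  finally show ?thesis .
qed

text \<open>The doubled centre \<open>\<rho> t - \<rho> w - 1\<close> of the inner factor and
  \<open>\<rho> w - \<rho> s\<close> of the geometric one add up to a value independent of
  \<open>w\<close>, so the summands can be added. The diagonal is excluded: the value 1 there has
  centre 0, not -1/2.\<close>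

lemma symmetric_unimodal_chow_fun:
  assumes "s \<in> carrier L" "t \<in> carrier L" "s \<sqsubseteq> t" "s \<noteq> t"
  shows "symmetric_unimodal (int (\<rho> t) - int (\<rho> s) - 1) (chow_fun L \<rho> s t)"
  using assms
proof (induction "\<rho> t - \<rho> s" arbitrary: s rule: less_induct)
  case less
  note st = less.prems
  have "symmetric_unimodal (int (\<rho> t) - int (\<rho> s) - 1)
      ((\<Sum>i=1..<\<rho> w - \<rho> s. monom 1 i) * chow_fun L \<rho> w t)"
    if "w \<in> \<lbrace>s..t\<rbrace> - {s, t}" for w
  proof -
    have w: "w \<in> carrier L" "s \<sqsubseteq> w" "w \<sqsubseteq> t" "s \<noteq> w" "w \<noteq> t"
      using that by (auto simp: mem_interval_iff)
    then have \<rho>: "\<rho> s < \<rho> w" "\<rho> w < \<rho> t"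
      using st rank_less by blast+
    then have "symmetric_unimodal (int (\<rho> t) - int (\<rho> w) - 1) (chow_fun L \<rho> w t)"
      using st w by (intro less.hyps) auto
    from symmetric_unimodal_geometric_mult[OF this, of "\<rho> w - \<rho> s"] \<rho> show ?thesis
      by (simp add: of_nat_diff algebra_simps)
  qed
  moreover have "symmetric_unimodal (int (\<rho> t) - int (\<rho> s) - 1) (\<Sum>i<\<rho> t - \<rho> s. monom 1 i)"
    using symmetric_unimodal_geometric[of "\<rho> t - \<rho> s"] rank_less[OF st] by (simp add: of_nat_diff)
  ultimately show ?case
    unfolding chow_fun_less[OF st] by (blast intro: symmetric_unimodal_add symmetric_unimodal_sum)
qed

text \<open>The centre is left unspecified because the one-element poset, with polynomial 1, does
  not follow the general formula.\<close>

lemma symmetric_unimodal_chow_poly: "\<exists>d. symmetric_unimodal d (chow_poly L \<rho>)"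
proof (cases "\<bottom> = \<top>")
  case True
  then have "chow_poly L \<rho> = 1"
    by (metis chow_poly_def chow_fun_refl bottom_closed)
  then have "symmetric_unimodal 0 (chow_poly L \<rho>)"
    using symmetric_unimodal_geometric[of 1] by (simp add: monom_0 one_pCons)
  then show ?thesis ..
next
  case False
  then show ?thesis
    unfolding chow_poly_def using symmetric_unimodal_chow_fun by blast
qed

end

theorem theorem4p18:
  fixes P :: "('a, 'm) gorder_scheme" and \<rho> :: "'a \<Rightarrow> nat"
  assumes "finite_graded_bounded_poset P \<rho>"
  shows "(\<forall>i. 0 \<le> coeff (chow_poly P \<rho>) i) \<and> unimodal (chow_poly P \<rho>)"
proof -
  obtain d where "symmetric_unimodal d (chow_poly P \<rho>)"
    using finite_graded_bounded_poset.symmetric_unimodal_chow_poly[OF assms] by blast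
  then show ?thesis
    using symmetric_unimodal_coeff_nonneg unimodal_if_symmetric_unimodal by blast
qed

end
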